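(* Let $\mathscr{G}$ be the species of graphs, $\mathscr{P}$ the species of point-determining graphs, $\mathscr{Q}$ the species of co-point-determining graphs, $\mathscr{E}_+$ the species of nonempty edgeless graphs, and $\mathscr{K}_+$ the species of nonempty complete graphs. Then $$\mathscr{G}=\mathscr{P}\circ\mathscr{E}_+=\mathscr{Q}\circ\mathscr{K}_+ .$$
   Context: All graphs are finite and simple (no loops, no multiple edges). A species $F$ is a functor from the category of finite sets with bijections to itself: it assigns to each finite set $U$ a finite set $F[U]$ of structures, and to each bijection $\sigma:U\to V$ a bijection $F[\sigma]:F[U]\to F[V]$. Equality of species means isomorphism (natural isomorphism of functors). For a species $F$ of graphs, $F[U]$ is a set of graphs with vertex set $U$ and $F[\sigma]$ is relabeling of vertices. For species $\Phi,\Psi$ with $\Psi[\varnothing]=\varnothing$, the composition $\Phi\circ\Psi$ is the species whose structures on $U$ are triples $(\pi,f,\gamma)$ where $\pi$ is a partition of $U$ into nonempty blocks, $f$ is a $\Phi$-structure on the set of blocks of $\pi$, and $\gamma=(\gamma_B)_{B\in\pi}$ with $\gamma_B$ a $\Psi$-structure on $B$. The neighborhood of a vertex is the set of vertices adjacent to it. A graph is point-determining if distinct vertices have distinct neighborhoods; it is co-point-determining if its complement is point-determining. The empty graph (no vertices) is a graph and is regarded as both point-determining and co-point-determining. An edgeless graph has no edges; a complete graph has every pair of distinct vertices adjacent. *)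

theory Defs
  imports Main "HOL-Library.FuncSet" "HOL-Library.Disjoint_Sets"
begin

text \<open>
  The finite sets are the finite sets over a label type \<open>'a\<close>; statements about species are
  polymorphic in \<open>'a\<close>. A bijection \<open>U \<rightarrow> V\<close> is a function \<open>\<sigma>\<close> with \<open>bij_betw \<sigma> U V\<close>, so its
  codomain \<open>V = \<sigma> ` U\<close> is determined and \<open>transport F U \<sigma>\<close> stands for \<open>F[\<sigma>] : F[U] \<rightarrow> F[V]\<close>.
\<close>

record ('a, 's) species =
  structures :: "'a set \<Rightarrow> 's set"
  transport :: "'a set \<Rightarrow> ('a \<Rightarrow> 'a) \<Rightarrow> 's \<Rightarrow> 's"

text \<open>
  The last clause says that \<open>F[\<sigma>]\<close> depends only on the values of \<open>\<sigma>\<close> on its domain \<open>U\<close>,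
  since HOL functions are total.
\<close>

definition is_species :: "('a, 's) species \<Rightarrow> bool" where
  "is_species F \<longleftrightarrow>
     (\<forall>U. finite U \<longrightarrow> finite (structures F U)) \<and>
     (\<forall>U V \<sigma>. finite U \<and> bij_betw \<sigma> U V \<longrightarrow>
        bij_betw (transport F U \<sigma>) (structures F U) (structures F V)) \<and>
     (\<forall>U. finite U \<longrightarrow> (\<forall>s\<in>structures F U. transport F U id s = s)) \<and>
     (\<forall>U V W \<sigma> \<tau>. finite U \<and> bij_betw \<sigma> U V \<and> bij_betw \<tau> V W \<longrightarrow>
        (\<forall>s\<in>structures F U.
           transport F U (\<tau> \<circ> \<sigma>) s = transport F V \<tau> (transport F U \<sigma> s))) \<and>
     (\<forall>U V \<sigma> \<tau>. finite U \<and> bij_betw \<sigma> U V \<and> (\<forall>x\<in>U. \<sigma> x = \<tau> x) \<longrightarrow>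
        (\<forall>s\<in>structures F U. transport F U \<sigma> s = transport F U \<tau> s))"

definition natural_iso ::
  "('a, 's) species \<Rightarrow> ('a, 't) species \<Rightarrow> ('a set \<Rightarrow> 's \<Rightarrow> 't) \<Rightarrow> bool" where
  "natural_iso F G \<eta> \<longleftrightarrow>
     (\<forall>U. finite U \<longrightarrow> bij_betw (\<eta> U) (structures F U) (structures G U)) \<and>
     (\<forall>U V \<sigma>. finite U \<and> bij_betw \<sigma> U V \<longrightarrow>
        (\<forall>s\<in>structures F U. \<eta> V (transport F U \<sigma> s) = transport G U \<sigma> (\<eta> U s)))"

definition species_iso :: "('a, 's) species \<Rightarrow> ('a, 't) species \<Rightarrow> bool"
    (infix "\<cong>\<^sub>S" 50) where
  "F \<cong>\<^sub>S G \<longleftrightarrow> is_species F \<and> is_species G \<and> (\<exists>\<eta>. natural_iso F G \<eta>)"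

text \<open>
  The blocks of a partition of \<open>U\<close> are labels of type \<open>'a set\<close> for \<open>\<Phi>\<close>. The family \<open>\<gamma>\<close> is an
  extensional function on the set of blocks. Along \<open>\<sigma>\<close>, a block \<open>B\<close> goes to \<open>\<sigma> ` B\<close>, \<open>\<Phi>\<close> is
  transported along the induced bijection of blocks, and the \<open>\<Psi>\<close>-structure on \<open>B\<close> along \<open>\<sigma>\<close>
  restricted to \<open>B\<close>; below \<open>B = U \<inter> \<sigma> -` C\<close> is the block with \<open>\<sigma> ` B = C\<close>.
  The composition is meant for \<open>\<Psi>\<close> with \<open>structures \<Psi> {} = {}\<close>.
\<close>

definition species_comp ::
  "('a set, 's) species \<Rightarrow> ('a, 't) species \<Rightarrow>
   ('a, 'a set set \<times> 's \<times> ('a set \<Rightarrow> 't)) species" (infixl "\<circ>\<^sub>S" 55) where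
  "\<Phi> \<circ>\<^sub>S \<Psi> =
     \<lparr> structures = (\<lambda>U. {(\<pi>, f, \<gamma>). partition_on U \<pi> \<and> f \<in> structures \<Phi> \<pi> \<and>
                                    \<gamma> \<in> (\<Pi>\<^sub>E B\<in>\<pi>. structures \<Psi> B)}),
       transport = (\<lambda>U \<sigma> (\<pi>, f, \<gamma>).
         ((`) \<sigma> ` \<pi>,
          transport \<Phi> \<pi> ((`) \<sigma>) f,
          (\<lambda>C\<in>(`) \<sigma> ` \<pi>. let B = U \<inter> \<sigma> -` C in transport \<Psi> B \<sigma> (\<gamma> B)))) \<rparr>"

text \<open>A graph is a pair of a vertex set and a set of edges, the edges being two-element sets.\<close>

type_synonym 'a graph = "'a set \<times> 'a set set"

abbreviation verts :: "'a graph \<Rightarrow> 'a set" where "verts \<equiv> fst"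
abbreviation edges :: "'a graph \<Rightarrow> 'a set set" where "edges \<equiv> snd"

definition is_graph :: "'a graph \<Rightarrow> bool" where
  "is_graph g \<longleftrightarrow> finite (verts g) \<and> (\<forall>e\<in>edges g. e \<subseteq> verts g \<and> card e = 2)"

definition relabel :: "('a \<Rightarrow> 'b) \<Rightarrow> 'a graph \<Rightarrow> 'b graph" where
  "relabel \<sigma> g = (\<sigma> ` verts g, (`) \<sigma> ` edges g)"

definition neighborhood :: "'a graph \<Rightarrow> 'a \<Rightarrow> 'a set" where
  "neighborhood g v = {w \<in> verts g. {v, w} \<in> edges g}"

definition complement :: "'a graph \<Rightarrow> 'a graph" where
  "complement g = (verts g, {e. e \<subseteq> verts g \<and> card e = 2 \<and> e \<notin> edges g})"

definition point_determining :: "'a graph \<Rightarrow> bool" where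
  "point_determining g \<longleftrightarrow>
     (\<forall>u\<in>verts g. \<forall>v\<in>verts g. u \<noteq> v \<longrightarrow> neighborhood g u \<noteq> neighborhood g v)"

definition co_point_determining :: "'a graph \<Rightarrow> bool" where
  "co_point_determining g \<longleftrightarrow> point_determining (complement g)"

definition edgeless :: "'a graph \<Rightarrow> bool" where
  "edgeless g \<longleftrightarrow> edges g = {}"

definition complete :: "'a graph \<Rightarrow> bool" where
  "complete g \<longleftrightarrow> (\<forall>u\<in>verts g. \<forall>v\<in>verts g. u \<noteq> v \<longrightarrow> {u, v} \<in> edges g)"

definition graph_species :: "('a graph \<Rightarrow> bool) \<Rightarrow> ('a, 'a graph) species" where
  "graph_species Q =
     \<lparr> structures = (\<lambda>U. {g. is_graph g \<and> verts g = U \<and> Q g}),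
       transport = (\<lambda>U \<sigma>. relabel \<sigma>) \<rparr>"

definition Graphs :: "('a, 'a graph) species" where
  "Graphs = graph_species (\<lambda>g. True)"

definition PointDet :: "('a, 'a graph) species" where
  "PointDet = graph_species point_determining"

definition CoPointDet :: "('a, 'a graph) species" where
  "CoPointDet = graph_species co_point_determining"

definition EdgelessPlus :: "('a, 'a graph) species" where
  "EdgelessPlus = graph_species (\<lambda>g. verts g \<noteq> {} \<and> edgeless g)"

definition CompletePlus :: "('a, 'a graph) species" where
  "CompletePlus = graph_species (\<lambda>g. verts g \<noteq> {} \<and> complete g)"

end

theory Submission
  imports Defs
begin

text \<open>
  Call two vertices of a graph twins if they have the same neighborhood. Twins are never adjacent,
  and whether two vertices are adjacent depends only on their twin classes. Hence a graph on
  \<open>U\<close> is the same thing as a partition of \<open>U\<close> into twin classes together with a graph on the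
  classes, and that quotient graph is point-determining because twin classes with the same
  neighborhood in the quotient would consist of twins. Conversely, replacing every vertex of a
  point-determining graph by an edgeless block makes each block a full twin class, so nothing is
  lost. This is the decomposition \<open>G = P \<circ> E\<^sub>+\<close>.

  One map serves both decompositions: \<open>inflate\<close> turns a partition, a graph \<open>f\<close> on its blocks and
  a graph on each block into a graph on \<open>U\<close>, joining vertices in different blocks according to \<open>f\<close>
  and vertices in the same block according to the graph on that block. It commutes with relabeling,
  whatever the two species of graphs are (\<open>inflate_natural\<close>). For \<open>P \<circ> E\<^sub>+\<close>
  it is bijective with inverse \<open>collapse\<close>, the passage to twin classes
  (\<open>bij_betw_inflate_edgeless\<close>).

  The map \<open>inflate\<close> also commutes with complementation, applied at once to the graph on the blocks
  and to the graph on every block (\<open>inflate_complement_all\<close>). Complementation exchanges \<open>P\<close> with \<open>Q\<close> and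
  \<open>E\<^sub>+\<close> with \<open>K\<^sub>+\<close>, so bijectivity for \<open>Q \<circ> K\<^sub>+\<close> follows
  from bijectivity for \<open>P \<circ> E\<^sub>+\<close>.
\<close>

section \<open>Species and their isomorphisms\<close>

text \<open>
  Bijectivity of \<open>F[\<sigma>]\<close> is automatic: functoriality makes \<open>F[\<sigma>\<inverse>]\<close> its
  inverse. Since \<open>\<sigma>\<inverse> \<circ> \<sigma>\<close> agrees with the identity only on \<open>U\<close>, this uses the
  independence of values outside the domain (\<open>cong\<close>).
\<close>

lemma is_speciesI:
  assumes "\<And>U. finite U \<Longrightarrow> finite (structures F U)"
    and into: "\<And>U V \<sigma> s. finite U \<Longrightarrow> bij_betw \<sigma> U V \<Longrightarrow> s \<in> structures F U \<Longrightarrow>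
           transport F U \<sigma> s \<in> structures F V"
    and ident: "\<And>U s. finite U \<Longrightarrow> s \<in> structures F U \<Longrightarrow> transport F U id s = s"
    and comp: "\<And>U V W \<sigma> \<tau> s. finite U \<Longrightarrow> bij_betw \<sigma> U V \<Longrightarrow> bij_betw \<tau> V W \<Longrightarrow> s \<in> structures F U \<Longrightarrow>
           transport F U (\<tau> \<circ> \<sigma>) s = transport F V \<tau> (transport F U \<sigma> s)"
    and cong: "\<And>U V \<sigma> \<tau> s. finite U \<Longrightarrow> bij_betw \<sigma> U V \<Longrightarrow> (\<And>x. x \<in> U \<Longrightarrow> \<sigma> x = \<tau> x) \<Longrightarrow> s \<in> structures F U \<Longrightarrow>
           transport F U \<sigma> s = transport F U \<tau> s"
  shows "is_species F"
proof -
  have cancel: "transport F V \<tau> (transport F U \<sigma> s) = s"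
    if U: "finite U" and \<sigma>: "bij_betw \<sigma> U V" and \<tau>: "bij_betw \<tau> V U"
      and inverse: "\<And>x. x \<in> U \<Longrightarrow> \<tau> (\<sigma> x) = x" and s: "s \<in> structures F U" for U V \<sigma> \<tau> s
  proof -
    have "transport F V \<tau> (transport F U \<sigma> s) = transport F U (\<tau> \<circ> \<sigma>) s"
      by (rule comp[OF U \<sigma> \<tau> s, symmetric])
    also have "\<dots> = transport F U id s"
      by (rule cong[OF U bij_betw_trans[OF \<sigma> \<tau>] _ s]) (simp add: inverse)
    also have "\<dots> = s"
      by (rule ident[OF U s])
    finally show ?thesis .
  qed
  have bij: "bij_betw (transport F U \<sigma>) (structures F U) (structures F V)"
    if U: "finite U" and \<sigma>: "bij_betw \<sigma> U V" for U V \<sigma>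
  proof (rule bij_betw_byWitness)
    let ?\<tau> = "inv_into U \<sigma>"
    have V: "finite V" and \<tau>: "bij_betw ?\<tau> V U"
      using U \<sigma> bij_betw_finite bij_betw_inv_into by blast+
    show "\<forall>s\<in>structures F U. transport F V ?\<tau> (transport F U \<sigma> s) = s"
      by (simp add: cancel[OF U \<sigma> \<tau>] bij_betw_inv_into_left[OF \<sigma>])
    show "\<forall>s\<in>structures F V. transport F U \<sigma> (transport F V ?\<tau> s) = s"
      by (simp add: cancel[OF V \<tau> \<sigma>] bij_betw_inv_into_right[OF \<sigma>])
    show "transport F U \<sigma> ` structures F U \<subseteq> structures F V"
      by (intro image_subsetI into[OF U \<sigma>])
    show "transport F V ?\<tau> ` structures F V \<subseteq> structures F U"
      by (intro image_subsetI into[OF V \<tau>])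
  qed
  show ?thesis
    unfolding is_species_def
  proof (intro conjI allI impI ballI; (elim conjE)?)
    fix U V W :: "'a set" and \<sigma> \<tau> :: "'a \<Rightarrow> 'a" and s
    assume U: "finite U"
    then show "finite (structures F U)" by (rule assms(1))
    { assume "s \<in> structures F U"
      then show "transport F U id s = s" by (rule ident[OF U]) }
    assume \<sigma>: "bij_betw \<sigma> U V"
    then show "bij_betw (transport F U \<sigma>) (structures F U) (structures F V)"
      by (rule bij[OF U])
    assume s: "s \<in> structures F U"
    { assume "bij_betw \<tau> V W"
      then show "transport F U (\<tau> \<circ> \<sigma>) s = transport F V \<tau> (transport F U \<sigma> s)"
        by (rule comp[OF U \<sigma> _ s]) }
    { assume "\<forall>x\<in>U. \<sigma> x = \<tau> x"
      then show "transport F U \<sigma> s = transport F U \<tau> s"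
        by (intro cong[OF U \<sigma> _ s]) simp }
  qed
qed

context
  fixes F :: "('a, 's) species"
  assumes F: "is_species F"
begin

lemma species_finite: "finite U \<Longrightarrow> finite (structures F U)"
  using F by (simp add: is_species_def)

lemma species_transport_in:
  assumes "finite U" and "bij_betw \<sigma> U V" and s: "s \<in> structures F U"
  shows "transport F U \<sigma> s \<in> structures F V"
proof -
  have "bij_betw (transport F U \<sigma>) (structures F U) (structures F V)"
    using F assms by (simp add: is_species_def)
  then show ?thesis using s by (rule bij_betw_apply)
qed

lemma species_transport_id:
  "finite U \<Longrightarrow> s \<in> structures F U \<Longrightarrow> transport F U id s = s"
  using F by (simp add: is_species_def)

lemma species_transport_comp:
  assumes "finite U" and "bij_betw \<sigma> U V" and "bij_betw \<tau> V W" and "s \<in> structures F U"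
  shows "transport F U (\<tau> \<circ> \<sigma>) s = transport F V \<tau> (transport F U \<sigma> s)"
proof -
  have "\<forall>U V W \<sigma> \<tau>. finite U \<and> bij_betw \<sigma> U V \<and> bij_betw \<tau> V W \<longrightarrow>
        (\<forall>s\<in>structures F U. transport F U (\<tau> \<circ> \<sigma>) s = transport F V \<tau> (transport F U \<sigma> s))"
    using F unfolding is_species_def by (elim conjE)
  from this[rule_format, OF _ assms(4)] show ?thesis
    using assms by auto
qed

lemma species_transport_cong:
  assumes "finite U" and "bij_betw \<sigma> U V" and "\<And>x. x \<in> U \<Longrightarrow> \<sigma> x = \<tau> x"
    and "s \<in> structures F U"
  shows "transport F U \<sigma> s = transport F U \<tau> s"
proof -
  have "\<forall>U V \<sigma> \<tau>. finite U \<and> bij_betw \<sigma> U V \<and> (\<forall>x\<in>U. \<sigma> x = \<tau> x) \<longrightarrow>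
        (\<forall>s\<in>structures F U. transport F U \<sigma> s = transport F U \<tau> s)"
    using F unfolding is_species_def by (elim conjE)
  from this[rule_format, OF _ assms(4)] show ?thesis
    using assms by auto
qed

end

lemma natural_iso_bij:
  "natural_iso F G \<eta> \<Longrightarrow> finite U \<Longrightarrow> bij_betw (\<eta> U) (structures F U) (structures G U)"
  by (simp add: natural_iso_def)

lemma natural_iso_natural:
  "natural_iso F G \<eta> \<Longrightarrow> finite U \<Longrightarrow> bij_betw \<sigma> U V \<Longrightarrow> s \<in> structures F U \<Longrightarrow>
    \<eta> V (transport F U \<sigma> s) = transport G U \<sigma> (\<eta> U s)"
  by (simp add: natural_iso_def)

lemma natural_isoI:
  assumes "\<And>U. finite U \<Longrightarrow> bij_betw (\<eta> U) (structures F U) (structures G U)"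
    and "\<And>U V \<sigma> s. finite U \<Longrightarrow> bij_betw \<sigma> U V \<Longrightarrow> s \<in> structures F U \<Longrightarrow>
      \<eta> V (transport F U \<sigma> s) = transport G U \<sigma> (\<eta> U s)"
  shows "natural_iso F G \<eta>"
  using assms by (simp add: natural_iso_def)

lemma species_iso_sym:
  assumes "F \<cong>\<^sub>S G"
  shows "G \<cong>\<^sub>S F"
proof -
  from assms obtain \<eta> where F: "is_species F" and G: "is_species G" and \<eta>: "natural_iso F G \<eta>"
    by (auto simp: species_iso_def)
  note bij = natural_iso_bij[OF \<eta>]
  let ?\<theta> = "\<lambda>U. inv_into (structures F U) (\<eta> U)"
  have "natural_iso G F ?\<theta>"
  proof (rule natural_isoI)
    fix U :: "'a set" assume "finite U"
    then show "bij_betw (?\<theta> U) (structures G U) (structures F U)"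
      by (intro bij_betw_inv_into bij)
  next
    fix U V :: "'a set" and \<sigma> t
    assume U: "finite U" and \<sigma>: "bij_betw \<sigma> U V" and t: "t \<in> structures G U"
    have V: "finite V" using U bij_betw_finite[OF \<sigma>] by simp
    obtain s where s: "s \<in> structures F U" and ts: "t = \<eta> U s"
      using bij_betw_imp_surj_on[OF bij[OF U]] t by (metis imageE)
    have "?\<theta> V (transport G U \<sigma> t) = ?\<theta> V (\<eta> V (transport F U \<sigma> s))"
      using natural_iso_natural[OF \<eta> U \<sigma> s] ts by simp
    also have "\<dots> = transport F U \<sigma> s"
      by (rule bij_betw_inv_into_left[OF bij[OF V] species_transport_in[OF F U \<sigma> s]])
    also have "s = ?\<theta> U t"
      using bij_betw_inv_into_left[OF bij[OF U] s] ts by simp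
    finally show "?\<theta> V (transport G U \<sigma> t) = transport F U \<sigma> (?\<theta> U t)" .
  qed
  then show ?thesis using F G by (auto simp: species_iso_def)
qed

lemma species_iso_trans:
  assumes "F \<cong>\<^sub>S G" and "G \<cong>\<^sub>S H"
  shows "F \<cong>\<^sub>S H"
proof -
  from assms obtain \<eta> \<theta> where sp: "is_species F" "is_species H"
    and \<eta>: "natural_iso F G \<eta>" and \<theta>: "natural_iso G H \<theta>"
    by (auto simp: species_iso_def)
  have "natural_iso F H (\<lambda>U. \<theta> U \<circ> \<eta> U)"
  proof (rule natural_isoI)
    fix U :: "'a set" assume U: "finite U"
    show "bij_betw (\<theta> U \<circ> \<eta> U) (structures F U) (structures H U)"
      by (rule bij_betw_trans[OF natural_iso_bij[OF \<eta> U] natural_iso_bij[OF \<theta> U]])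
  next
    fix U V :: "'a set" and \<sigma> s
    assume U: "finite U" and \<sigma>: "bij_betw \<sigma> U V" and s: "s \<in> structures F U"
    show "(\<theta> V \<circ> \<eta> V) (transport F U \<sigma> s) = transport H U \<sigma> ((\<theta> U \<circ> \<eta> U) s)"
      using natural_iso_natural[OF \<eta> U \<sigma> s]
        natural_iso_natural[OF \<theta> U \<sigma> bij_betw_apply[OF natural_iso_bij[OF \<eta> U] s]] by simp
  qed
  then show ?thesis using sp by (auto simp: species_iso_def)
qed

section \<open>Composition of species\<close>

text \<open>
  The transport of a composition recovers a block \<open>B\<close> from its image as \<open>U \<inter> \<sigma> -` (\<sigma> ` B)\<close>.
\<close>

lemma bij_betw_vimage_image:
  "bij_betw \<sigma> U V \<Longrightarrow> B \<subseteq> U \<Longrightarrow> U \<inter> \<sigma> -` (\<sigma> ` B) = B"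
  by (auto simp: bij_betw_def inj_on_def)

lemma partition_on_bij_image:
  assumes "partition_on U \<pi>" and "bij_betw \<sigma> U V"
  shows "partition_on V ((`) \<sigma> ` \<pi>)"
proof -
  have "{} \<notin> (`) \<sigma> ` \<pi>" using partition_onD3[OF assms(1)] by auto
  then show ?thesis
    using partition_on_inj_image[OF assms(1)] assms(2) unfolding bij_betw_def by force
qed

lemma bij_betw_blocks:
  assumes "partition_on U \<pi>" and "bij_betw \<sigma> U V"
  shows "bij_betw ((`) \<sigma>) \<pi> ((`) \<sigma> ` \<pi>)"
proof -
  have "inj_on ((`) \<sigma>) (Pow U)" using assms(2) inj_on_image_Pow bij_betw_def by blast
  moreover have "\<pi> \<subseteq> Pow U" using assms(1) partition_onD1 by blast
  ultimately show ?thesis by (metis inj_on_subset bij_betw_imageI)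
qed

lemma transport_comp_eq:
  "transport (\<Phi> \<circ>\<^sub>S \<Psi>) U \<sigma> (\<pi>, f, \<gamma>) =
    ((`) \<sigma> ` \<pi>, transport \<Phi> \<pi> ((`) \<sigma>) f,
     \<lambda>C\<in>(`) \<sigma> ` \<pi>. transport \<Psi> (U \<inter> \<sigma> -` C) \<sigma> (\<gamma> (U \<inter> \<sigma> -` C)))"
  by (simp add: species_comp_def Let_def)

lemma structures_comp_iff:
  "(\<pi>, f, \<gamma>) \<in> structures (\<Phi> \<circ>\<^sub>S \<Psi>) U \<longleftrightarrow>
    partition_on U \<pi> \<and> f \<in> structures \<Phi> \<pi> \<and> \<gamma> \<in> (\<Pi>\<^sub>E B\<in>\<pi>. structures \<Psi> B)"
  by (simp add: species_comp_def)

text \<open>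
  Functoriality is inherited componentwise: a bijection \<open>\<sigma>\<close> of \<open>U\<close> induces the bijection
  \<open>(`) \<sigma>\<close> of the blocks, to which functoriality of \<open>\<Phi>\<close> applies, and restricts to a bijection
  on each block, to which functoriality of \<open>\<Psi>\<close> applies.
\<close>

lemma is_species_comp:
  assumes \<Phi>: "is_species \<Phi>" and \<Psi>: "is_species \<Psi>"
  shows "is_species (\<Phi> \<circ>\<^sub>S \<Psi>)"
proof (rule is_speciesI)
  fix U :: "'a set" assume U: "finite U"
  have "finite {\<pi>. partition_on U \<pi>}"
    by (rule finitely_many_partition_on[OF U])
  moreover have "finite (structures \<Phi> \<pi> \<times> (\<Pi>\<^sub>E B\<in>\<pi>. structures \<Psi> B))" if "partition_on U \<pi>" for \<pi>
  proof -
    have "finite \<pi>" "\<And>B. B \<in> \<pi> \<Longrightarrow> finite B"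
      using that U finite_elements partition_onD1 by (blast, metis Sup_upper finite_subset)
    then show ?thesis
      using species_finite[OF \<Phi>] species_finite[OF \<Psi>] by (intro finite_cartesian_product finite_PiE) auto
  qed
  ultimately have "finite (SIGMA \<pi>:{\<pi>. partition_on U \<pi>}. structures \<Phi> \<pi> \<times> (\<Pi>\<^sub>E B\<in>\<pi>. structures \<Psi> B))"
    by (rule finite_SigmaI) simp_all
  then show "finite (structures (\<Phi> \<circ>\<^sub>S \<Psi>) U)"
    by (rule finite_subset[rotated]) (auto simp: species_comp_def)
next
  fix U V :: "'a set" and \<sigma> :: "'a \<Rightarrow> 'a" and s
  assume U: "finite U" and \<sigma>: "bij_betw \<sigma> U V" and "s \<in> structures (\<Phi> \<circ>\<^sub>S \<Psi>) U"
  then obtain \<pi> f \<gamma> where s: "s = (\<pi>, f, \<gamma>)" and \<pi>: "partition_on U \<pi>"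
    and f: "f \<in> structures \<Phi> \<pi>" and \<gamma>: "\<gamma> \<in> (\<Pi>\<^sub>E B\<in>\<pi>. structures \<Psi> B)"
    by (cases s) (auto simp: structures_comp_iff)
  have sub: "B \<subseteq> U" if "B \<in> \<pi>" for B using \<pi> that partition_onD1 by blast
  have "transport \<Psi> (U \<inter> \<sigma> -` \<sigma> ` B) \<sigma> (\<gamma> (U \<inter> \<sigma> -` \<sigma> ` B)) \<in> structures \<Psi> (\<sigma> ` B)"
    if "B \<in> \<pi>" for B
    using that sub[OF that] \<gamma> U \<sigma>
    by (auto simp: bij_betw_vimage_image intro!: species_transport_in[OF \<Psi>]
        dest: finite_subset bij_betw_subset)
  then show "transport (\<Phi> \<circ>\<^sub>S \<Psi>) U \<sigma> s \<in> structures (\<Phi> \<circ>\<^sub>S \<Psi>) V"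
    unfolding s transport_comp_eq structures_comp_iff
    using partition_on_bij_image[OF \<pi> \<sigma>] bij_betw_blocks[OF \<pi> \<sigma>] f
      species_transport_in[OF \<Phi> finite_elements[OF U \<pi>]]
    by (auto simp del: restrict_apply simp: restrict_PiE_iff)
next
  fix U :: "'a set" and s
  assume U: "finite U" and "s \<in> structures (\<Phi> \<circ>\<^sub>S \<Psi>) U"
  then obtain \<pi> f \<gamma> where s: "s = (\<pi>, f, \<gamma>)" and \<pi>: "partition_on U \<pi>"
    and f: "f \<in> structures \<Phi> \<pi>" and \<gamma>: "\<gamma> \<in> (\<Pi>\<^sub>E B\<in>\<pi>. structures \<Psi> B)"
    by (cases s) (auto simp: structures_comp_iff)
  have sub: "B \<subseteq> U" if "B \<in> \<pi>" for B using \<pi> that partition_onD1 by blast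
  have img: "(`) id = (id :: 'a set \<Rightarrow> _)" by auto
  have "(\<lambda>C\<in>\<pi>. transport \<Psi> (U \<inter> id -` C) id (\<gamma> (U \<inter> id -` C))) = \<gamma>"
  proof (rule extensionalityI)
    fix B assume B: "B \<in> \<pi>"
    then have "U \<inter> B = B" "finite B" using sub U finite_subset by blast+
    then show "(\<lambda>C\<in>\<pi>. transport \<Psi> (U \<inter> id -` C) id (\<gamma> (U \<inter> id -` C))) B = \<gamma> B"
      using B \<gamma> species_transport_id[OF \<Psi>] by auto
  qed (use \<gamma> in \<open>auto simp: PiE_def\<close>)
  then show "transport (\<Phi> \<circ>\<^sub>S \<Psi>) U id s = s"
    unfolding s transport_comp_eq img
    using species_transport_id[OF \<Phi> finite_elements[OF U \<pi>] f] by simp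
next
  fix U V W :: "'a set" and \<sigma> \<tau> :: "'a \<Rightarrow> 'a" and s
  assume U: "finite U" and \<sigma>: "bij_betw \<sigma> U V" and \<tau>: "bij_betw \<tau> V W"
    and "s \<in> structures (\<Phi> \<circ>\<^sub>S \<Psi>) U"
  then obtain \<pi> f \<gamma> where s: "s = (\<pi>, f, \<gamma>)" and \<pi>: "partition_on U \<pi>"
    and f: "f \<in> structures \<Phi> \<pi>" and \<gamma>: "\<gamma> \<in> (\<Pi>\<^sub>E B\<in>\<pi>. structures \<Psi> B)"
    by (cases s) (auto simp: structures_comp_iff)
  have img: "(`) (\<tau> \<circ> \<sigma>) = (`) \<tau> \<circ> (`) \<sigma>" by (auto simp: image_comp)
  have blocks: "(`) (\<tau> \<circ> \<sigma>) ` \<pi> = (`) \<tau> ` (`) \<sigma> ` \<pi>" by (simp add: img image_comp)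
  have "transport \<Phi> \<pi> ((`) (\<tau> \<circ> \<sigma>)) f = transport \<Phi> ((`) \<sigma> ` \<pi>) ((`) \<tau>) (transport \<Phi> \<pi> ((`) \<sigma>) f)"
    unfolding img
    by (rule species_transport_comp[OF \<Phi> finite_elements[OF U \<pi>] bij_betw_blocks[OF \<pi> \<sigma>]
          bij_betw_blocks[OF partition_on_bij_image[OF \<pi> \<sigma>] \<tau>] f])
  moreover have "(\<lambda>C\<in>(`) (\<tau> \<circ> \<sigma>) ` \<pi>. transport \<Psi> (U \<inter> (\<tau> \<circ> \<sigma>) -` C) (\<tau> \<circ> \<sigma>) (\<gamma> (U \<inter> (\<tau> \<circ> \<sigma>) -` C))) =
    (\<lambda>C\<in>(`) \<tau> ` (`) \<sigma> ` \<pi>. transport \<Psi> (V \<inter> \<tau> -` C) \<tau>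
      ((\<lambda>C\<in>(`) \<sigma> ` \<pi>. transport \<Psi> (U \<inter> \<sigma> -` C) \<sigma> (\<gamma> (U \<inter> \<sigma> -` C))) (V \<inter> \<tau> -` C)))"
    unfolding blocks
  proof (rule restrict_ext)
    fix C assume "C \<in> (`) \<tau> ` (`) \<sigma> ` \<pi>"
    then obtain B where B: "B \<in> \<pi>" and C: "C = \<tau> ` \<sigma> ` B" by blast
    have BU: "B \<subseteq> U" using \<pi> B partition_onD1 by blast
    have BV: "\<sigma> ` B \<subseteq> V" using BU \<sigma> bij_betw_imp_surj_on by blast
    have 1: "V \<inter> \<tau> -` C = \<sigma> ` B" "U \<inter> \<sigma> -` \<sigma> ` B = B" "U \<inter> (\<tau> \<circ> \<sigma>) -` C = B"
      using bij_betw_vimage_image[OF \<tau> BV] bij_betw_vimage_image[OF \<sigma> BU]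
        bij_betw_vimage_image[OF bij_betw_trans[OF \<sigma> \<tau>] BU]
      by (simp_all add: C image_comp)
    have "finite B" "bij_betw \<sigma> B (\<sigma> ` B)" "bij_betw \<tau> (\<sigma> ` B) (\<tau> ` \<sigma> ` B)" "\<gamma> B \<in> structures \<Psi> B"
      using U BU BV \<sigma> \<tau> B \<gamma> by (auto intro: finite_subset bij_betw_subset)
    then have "transport \<Psi> B (\<tau> \<circ> \<sigma>) (\<gamma> B) = transport \<Psi> (\<sigma> ` B) \<tau> (transport \<Psi> B \<sigma> (\<gamma> B))"
      by (rule species_transport_comp[OF \<Psi>])
    then show "transport \<Psi> (U \<inter> (\<tau> \<circ> \<sigma>) -` C) (\<tau> \<circ> \<sigma>) (\<gamma> (U \<inter> (\<tau> \<circ> \<sigma>) -` C)) =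
      transport \<Psi> (V \<inter> \<tau> -` C) \<tau>
        ((\<lambda>C\<in>(`) \<sigma> ` \<pi>. transport \<Psi> (U \<inter> \<sigma> -` C) \<sigma> (\<gamma> (U \<inter> \<sigma> -` C))) (V \<inter> \<tau> -` C))"
      using B by (simp add: 1)
  qed
  ultimately show "transport (\<Phi> \<circ>\<^sub>S \<Psi>) U (\<tau> \<circ> \<sigma>) s = transport (\<Phi> \<circ>\<^sub>S \<Psi>) V \<tau> (transport (\<Phi> \<circ>\<^sub>S \<Psi>) U \<sigma> s)"
    unfolding s transport_comp_eq blocks by simp
next
  fix U V :: "'a set" and \<sigma> \<tau> :: "'a \<Rightarrow> 'a" and s
  assume U: "finite U" and \<sigma>: "bij_betw \<sigma> U V" and eq: "\<And>x. x \<in> U \<Longrightarrow> \<sigma> x = \<tau> x"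
    and "s \<in> structures (\<Phi> \<circ>\<^sub>S \<Psi>) U"
  then obtain \<pi> f \<gamma> where s: "s = (\<pi>, f, \<gamma>)" and \<pi>: "partition_on U \<pi>"
    and f: "f \<in> structures \<Phi> \<pi>" and \<gamma>: "\<gamma> \<in> (\<Pi>\<^sub>E B\<in>\<pi>. structures \<Psi> B)"
    by (cases s) (auto simp: structures_comp_iff)
  have sub: "B \<subseteq> U" if "B \<in> \<pi>" for B using \<pi> that partition_onD1 by blast
  have img: "\<sigma> ` B = \<tau> ` B" if "B \<in> \<pi>" for B
    using sub[OF that] eq by (auto intro!: image_cong)
  then have blocks: "(`) \<tau> ` \<pi> = (`) \<sigma> ` \<pi>" by (auto intro!: image_cong)
  have pre: "U \<inter> \<tau> -` C = U \<inter> \<sigma> -` C" for C using eq by auto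
  have "transport \<Phi> \<pi> ((`) \<sigma>) f = transport \<Phi> \<pi> ((`) \<tau>) f"
    by (rule species_transport_cong[OF \<Phi> finite_elements[OF U \<pi>] bij_betw_blocks[OF \<pi> \<sigma>] img f])
  moreover have "transport \<Psi> (U \<inter> \<sigma> -` \<sigma> ` B) \<sigma> (\<gamma> (U \<inter> \<sigma> -` \<sigma> ` B)) =
      transport \<Psi> (U \<inter> \<sigma> -` \<sigma> ` B) \<tau> (\<gamma> (U \<inter> \<sigma> -` \<sigma> ` B))" if B: "B \<in> \<pi>" for B
    unfolding bij_betw_vimage_image[OF \<sigma> sub[OF B]]
    by (rule species_transport_cong[OF \<Psi>])
       (use U \<sigma> eq \<gamma> B sub[OF B] in \<open>auto intro: finite_subset bij_betw_subset\<close>)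
  ultimately show "transport (\<Phi> \<circ>\<^sub>S \<Psi>) U \<sigma> s = transport (\<Phi> \<circ>\<^sub>S \<Psi>) U \<tau> s"
    unfolding s transport_comp_eq blocks pre by (auto intro!: restrict_ext)
qed

section \<open>Graphs, relabeling and complements\<close>

lemma edge_verts:
  assumes "is_graph g" and "{u, v} \<in> edges g"
  shows "u \<in> verts g" and "v \<in> verts g" and "u \<noteq> v"
  using assms unfolding is_graph_def by (auto dest!: bspec)

text \<open>
  Reduces equality of edge sets to adjacency of pairs, the form in which every graph
  construction below is characterized.
\<close>

lemma graph_eqI:
  assumes g: "is_graph g" and h: "is_graph h" and "verts g = verts h"
    and adj: "\<And>u v. u \<in> verts g \<Longrightarrow> v \<in> verts g \<Longrightarrow> u \<noteq> v \<Longrightarrow> {u, v} \<in> edges g \<longleftrightarrow> {u, v} \<in> edges h"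
  shows "g = h"
proof (rule prod_eqI)
  show "edges g = edges h"
  proof (rule set_eqI)
    fix e
    have "\<exists>u v. e = {u, v} \<and> u \<noteq> v \<and> u \<in> verts g \<and> v \<in> verts g" if "e \<in> edges g \<or> e \<in> edges h"
    proof -
      have "card e = 2" "e \<subseteq> verts g" using that g h assms(3) by (auto simp: is_graph_def)
      then show ?thesis by (auto simp: card_2_iff)
    qed
    then show "e \<in> edges g \<longleftrightarrow> e \<in> edges h" using adj by metis
  qed
qed (rule assms(3))

lemma verts_relabel [simp]: "verts (relabel \<sigma> g) = \<sigma> ` verts g"
  by (simp add: relabel_def)

lemma is_graph_relabel:
  assumes g: "is_graph g" and \<sigma>: "inj_on \<sigma> (verts g)"
  shows "is_graph (relabel \<sigma> g)"
proof -
  have "card (\<sigma> ` e) = 2" if "e \<in> edges g" for e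
  proof -
    have "e \<subseteq> verts g" "card e = 2" using g that by (auto simp: is_graph_def)
    then show ?thesis using card_image[OF inj_on_subset[OF \<sigma>]] by simp
  qed
  then show ?thesis using g by (auto simp: is_graph_def relabel_def)
qed

lemma relabel_adjacent_iff:
  assumes g: "is_graph g" and \<sigma>: "inj_on \<sigma> (verts g)" and u: "u \<in> verts g" and v: "v \<in> verts g"
  shows "{\<sigma> u, \<sigma> v} \<in> edges (relabel \<sigma> g) \<longleftrightarrow> {u, v} \<in> edges g"
proof -
  have "\<sigma> ` {u, v} = \<sigma> ` e \<longleftrightarrow> {u, v} = e" if "e \<in> edges g" for e
    using inj_on_image_eq_iff[OF \<sigma>, of "{u, v}" e] that g u v by (auto simp: is_graph_def)
  then show ?thesis by (auto simp: relabel_def image_iff)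
qed

lemma is_graph_complement [simp]: "is_graph g \<Longrightarrow> is_graph (complement g)"
  by (simp add: is_graph_def complement_def)

lemma verts_complement [simp]: "verts (complement g) = verts g"
  by (simp add: complement_def)

lemma complement_adjacent_iff:
  "u \<in> verts g \<Longrightarrow> v \<in> verts g \<Longrightarrow> u \<noteq> v \<Longrightarrow> {u, v} \<in> edges (complement g) \<longleftrightarrow> {u, v} \<notin> edges g"
  by (simp add: complement_def)

lemma complement_complement: "is_graph g \<Longrightarrow> complement (complement g) = g"
  by (rule graph_eqI) (simp_all add: complement_adjacent_iff)

lemma complement_relabel:
  assumes g: "is_graph g" and \<sigma>: "inj_on \<sigma> (verts g)"
  shows "complement (relabel \<sigma> g) = relabel \<sigma> (complement g)"
proof (rule graph_eqI)
  fix x y assume "x \<in> verts (complement (relabel \<sigma> g))" "y \<in> verts (complement (relabel \<sigma> g))" "x \<noteq> y"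
  then obtain u v where "x = \<sigma> u" "y = \<sigma> v" "u \<in> verts g" "v \<in> verts g" "u \<noteq> v" "\<sigma> u \<noteq> \<sigma> v"
    by auto
  then show "{x, y} \<in> edges (complement (relabel \<sigma> g)) \<longleftrightarrow> {x, y} \<in> edges (relabel \<sigma> (complement g))"
    using relabel_adjacent_iff[OF g \<sigma>] relabel_adjacent_iff[of "complement g" \<sigma>] g \<sigma>
    by (simp add: complement_adjacent_iff)
qed (use g \<sigma> in \<open>simp_all add: is_graph_relabel\<close>)

lemma edgeless_complement_iff: "is_graph g \<Longrightarrow> edgeless (complement g) \<longleftrightarrow> complete g"
proof
  assume "edgeless (complement g)"
  then show "complete g"
    unfolding complete_def edgeless_def by (metis complement_adjacent_iff empty_iff)
next
  assume g: "is_graph g" "complete g"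
  show "edgeless (complement g)"
    using g by (auto simp: edgeless_def complete_def complement_def card_2_iff)
qed

lemma complete_complement: "is_graph g \<Longrightarrow> edgeless g \<Longrightarrow> complete (complement g)"
  using edgeless_complement_iff[of "complement g"] by (simp add: complement_complement)

lemma neighborhood_relabel:
  assumes g: "is_graph g" and \<sigma>: "inj_on \<sigma> (verts g)" and v: "v \<in> verts g"
  shows "neighborhood (relabel \<sigma> g) (\<sigma> v) = \<sigma> ` neighborhood g v"
  using relabel_adjacent_iff[OF g \<sigma> v] by (auto simp: neighborhood_def)

lemma point_determining_relabel:
  assumes g: "is_graph g" and \<sigma>: "inj_on \<sigma> (verts g)" and "point_determining g"
  shows "point_determining (relabel \<sigma> g)"
proof -
  have "\<sigma> ` neighborhood g u \<noteq> \<sigma> ` neighborhood g v"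
    if "u \<in> verts g" "v \<in> verts g" "u \<noteq> v" for u v
    using assms(3) that inj_on_image_eq_iff[OF \<sigma>, of "neighborhood g u" "neighborhood g v"]
    by (auto simp: point_determining_def neighborhood_def)
  then show ?thesis
    by (auto simp: point_determining_def neighborhood_relabel[OF g \<sigma>])
qed

lemma co_point_determining_relabel:
  "is_graph g \<Longrightarrow> inj_on \<sigma> (verts g) \<Longrightarrow> co_point_determining g \<Longrightarrow>
    co_point_determining (relabel \<sigma> g)"
  by (simp add: co_point_determining_def complement_relabel point_determining_relabel)

lemma edgeless_relabel: "edgeless g \<Longrightarrow> edgeless (relabel \<sigma> g)"
  by (simp add: edgeless_def relabel_def)

lemma complete_relabel:
  "is_graph g \<Longrightarrow> inj_on \<sigma> (verts g) \<Longrightarrow> complete g \<Longrightarrow> complete (relabel \<sigma> g)"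
  by (auto simp: complete_def relabel_adjacent_iff)

section \<open>Species of graphs\<close>

lemma structures_graph_species [simp]:
  "g \<in> structures (graph_species P) U \<longleftrightarrow> is_graph g \<and> verts g = U \<and> P g"
  by (simp add: graph_species_def)

lemma transport_graph_species [simp]: "transport (graph_species P) U \<sigma> g = relabel \<sigma> g"
  by (simp add: graph_species_def)

text \<open>
  The only thing to check about a property of graphs is its invariance under relabeling.
\<close>

lemma is_species_graph_species:
  assumes P: "\<And>g \<sigma>. is_graph g \<Longrightarrow> inj_on \<sigma> (verts g) \<Longrightarrow> P g \<Longrightarrow> P (relabel \<sigma> g)"
  shows "is_species (graph_species P)"
proof (rule is_speciesI)
  fix U :: "'a set" assume "finite U"
  moreover have "structures (graph_species P) U \<subseteq> {U} \<times> Pow (Pow U)"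
  proof
    fix g assume "g \<in> structures (graph_species P) U"
    then show "g \<in> {U} \<times> Pow (Pow U)" by (cases g) (auto simp: is_graph_def)
  qed
  ultimately show "finite (structures (graph_species P) U)"
    by (simp add: finite_subset)
next
  fix U V :: "'a set" and \<sigma> g
  assume "bij_betw \<sigma> U V" "g \<in> structures (graph_species P) U"
  then show "transport (graph_species P) U \<sigma> g \<in> structures (graph_species P) V"
    by (clarsimp simp: bij_betw_def P is_graph_relabel)
next
  fix U :: "'a set" and g
  show "transport (graph_species P) U id g = g"
    by (simp add: relabel_def image_def)
next
  fix U V :: "'a set" and \<sigma> \<tau> g
  show "transport (graph_species P) U (\<tau> \<circ> \<sigma>) g =
      transport (graph_species P) V \<tau> (transport (graph_species P) U \<sigma> g)"
    by (simp add: relabel_def image_comp image_image)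
next
  fix U :: "'a set" and \<sigma> \<tau> :: "'a \<Rightarrow> 'a" and g
  assume eq: "\<And>x. x \<in> U \<Longrightarrow> \<sigma> x = \<tau> x" and g: "g \<in> structures (graph_species P) U"
  have "\<sigma> ` e = \<tau> ` e" if "e \<in> edges g" for e
    using g that eq by (intro image_cong) (auto simp: is_graph_def)
  then show "transport (graph_species P) U \<sigma> g = transport (graph_species P) U \<tau> g"
    using g eq by (auto simp: relabel_def intro!: image_cong)
qed

lemma structures_graph_comp_iff:
  "(\<pi>, f, \<gamma>) \<in> structures (graph_species P \<circ>\<^sub>S graph_species Q) U \<longleftrightarrow>
    partition_on U \<pi> \<and> is_graph f \<and> verts f = \<pi> \<and> P f \<and> \<gamma> \<in> extensional \<pi> \<and>
    (\<forall>B\<in>\<pi>. is_graph (\<gamma> B) \<and> verts (\<gamma> B) = B \<and> Q (\<gamma> B))"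
  by (auto simp: structures_comp_iff PiE_def Pi_def)

section \<open>Inflating the vertices of a graph\<close>

text \<open>
  Also known as the generalized lexicographic product or modular substitution: each block is a
  module of the resulting graph.
\<close>

definition inflate ::
  "'a set set \<times> 'a set graph \<times> ('a set \<Rightarrow> 'a graph) \<Rightarrow> 'a graph" where
  "inflate = (\<lambda>(\<pi>, f, \<gamma>).
     (\<Union>\<pi>, {{u, v} | u v. \<exists>B\<in>\<pi>. \<exists>C\<in>\<pi>. u \<in> B \<and> v \<in> C \<and> {B, C} \<in> edges f} \<union> (\<Union>B\<in>\<pi>. edges (\<gamma> B))))"

lemma partition_on_unique_block:
  "partition_on U \<pi> \<Longrightarrow> B \<in> \<pi> \<Longrightarrow> C \<in> \<pi> \<Longrightarrow> u \<in> B \<Longrightarrow> u \<in> C \<Longrightarrow> B = C"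
  using partition_onD2[of U \<pi>] by (auto dest: disjointD)

context
  fixes U \<pi> f \<gamma>
  assumes U: "finite U" and \<pi>: "partition_on U \<pi>"
    and f: "is_graph f" and vf: "verts f = \<pi>"
    and \<gamma>: "\<And>B. B \<in> \<pi> \<Longrightarrow> is_graph (\<gamma> B)" and v\<gamma>: "\<And>B. B \<in> \<pi> \<Longrightarrow> verts (\<gamma> B) = B"
begin

lemma verts_inflate: "verts (inflate (\<pi>, f, \<gamma>)) = U"
  using partition_onD1[OF \<pi>] by (simp add: inflate_def)

text \<open>
  No loops arise from the first kind of edges, as \<open>f\<close> has no loops and blocks are disjoint.
\<close>

lemma is_graph_inflate: "is_graph (inflate (\<pi>, f, \<gamma>))"
proof -
  have "e \<subseteq> U \<and> card e = 2" if "e \<in> edges (inflate (\<pi>, f, \<gamma>))" for e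
  proof -
    from that consider (across) u v B C where "e = {u, v}" "B \<in> \<pi>" "C \<in> \<pi>" "u \<in> B" "v \<in> C" "{B, C} \<in> edges f"
      | (inside) B where "B \<in> \<pi>" "e \<in> edges (\<gamma> B)"
      by (auto simp: inflate_def)
    then show ?thesis
    proof cases
      case across
      then have "u \<noteq> v"
        using edge_verts(3)[OF f] partition_on_unique_block[OF \<pi>] by blast
      then show ?thesis
        using across partition_onD1[OF \<pi>] by auto
    next
      case inside
      then show ?thesis
        using \<gamma>[OF inside(1)] v\<gamma>[OF inside(1)] partition_onD1[OF \<pi>] by (auto simp: is_graph_def)
    qed
  qed
  then show ?thesis using U verts_inflate by (simp add: is_graph_def)
qed

text \<open>
  Blocks are determined by their elements, so the two kinds of edges in the definition of
  \<open>inflate\<close> cannot interfere with each other.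
\<close>

lemma inflate_adjacent_iff:
  assumes B: "B \<in> \<pi>" "u \<in> B" and C: "C \<in> \<pi>" "v \<in> C"
  shows "{u, v} \<in> edges (inflate (\<pi>, f, \<gamma>)) \<longleftrightarrow>
    (if B = C then {u, v} \<in> edges (\<gamma> B) else {B, C} \<in> edges f)"
proof -
  have block: "D = E" if "D \<in> \<pi>" "E \<in> \<pi>" "w \<in> D" "w \<in> E" for D E w
    using partition_on_unique_block[OF \<pi>] that .
  have inside: "D = B \<and> D = C" if "D \<in> \<pi>" "{u, v} \<in> edges (\<gamma> D)" for D
    using edge_verts[OF \<gamma>[OF that(1)] that(2)] v\<gamma>[OF that(1)] block that B C by blast
  have across: "{B, C} \<in> edges f"
    if D: "D \<in> \<pi>" "E \<in> \<pi>" "w \<in> D" "x \<in> E" and "{D, E} \<in> edges f" "{u, v} = {w, x}" for D E w x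
  proof -
    have "(w = u \<and> x = v) \<or> (w = v \<and> x = u)" using that by (auto simp: doubleton_eq_iff)
    then have "(D = B \<and> E = C) \<or> (D = C \<and> E = B)" using block B C D by blast
    then show ?thesis using that by (auto simp: insert_commute)
  qed
  have "{u, v} \<in> edges (inflate (\<pi>, f, \<gamma>)) \<longleftrightarrow>
    {B, C} \<in> edges f \<or> (B = C \<and> {u, v} \<in> edges (\<gamma> B))"
  proof
    assume "{u, v} \<in> edges (inflate (\<pi>, f, \<gamma>))"
    then consider w x D E where "{u, v} = {w, x}" "D \<in> \<pi>" "E \<in> \<pi>" "w \<in> D" "x \<in> E" "{D, E} \<in> edges f"
      | D where "D \<in> \<pi>" "{u, v} \<in> edges (\<gamma> D)"
      unfolding inflate_def by auto
    then show "{B, C} \<in> edges f \<or> (B = C \<and> {u, v} \<in> edges (\<gamma> B))"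
      using across inside by cases blast+
  next
    assume "{B, C} \<in> edges f \<or> (B = C \<and> {u, v} \<in> edges (\<gamma> B))"
    then show "{u, v} \<in> edges (inflate (\<pi>, f, \<gamma>))"
      using B C by (auto simp: inflate_def)
  qed
  then show ?thesis using edge_verts(3)[OF f, of B C] by auto
qed

end

text \<open>
  Adjacency in an inflated graph is expressed through blocks and their graphs alone, and a bijection
  transports all of these. The argument applies to all species of graphs, which is why naturality
  needs to be shown only once for both decompositions.
\<close>

lemma inflate_natural:
  assumes P: "is_species (graph_species P)" and Q: "is_species (graph_species Q)"
    and U: "finite U" and \<sigma>: "bij_betw \<sigma> U V"
    and s: "s \<in> structures (graph_species P \<circ>\<^sub>S graph_species Q) U"
  shows "inflate (transport (graph_species P \<circ>\<^sub>S graph_species Q) U \<sigma> s) = relabel \<sigma> (inflate s)"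
proof -
  obtain \<pi> f \<gamma> where s_eq: "s = (\<pi>, f, \<gamma>)" by (cases s)
  have \<pi>: "partition_on U \<pi>" and f: "is_graph f" "verts f = \<pi>"
    and \<gamma>: "\<And>B. B \<in> \<pi> \<Longrightarrow> is_graph (\<gamma> B)" "\<And>B. B \<in> \<pi> \<Longrightarrow> verts (\<gamma> B) = B"
    using s by (simp_all add: s_eq structures_graph_comp_iff)
  define \<gamma>' where "\<gamma>' = (\<lambda>C\<in>(`) \<sigma> ` \<pi>. relabel \<sigma> (\<gamma> (U \<inter> \<sigma> -` C)))"
  have tr: "transport (graph_species P \<circ>\<^sub>S graph_species Q) U \<sigma> s =
      ((`) \<sigma> ` \<pi>, relabel ((`) \<sigma>) f, \<gamma>')"
    by (simp add: s_eq transport_comp_eq \<gamma>'_def)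
  have V: "finite V" using U bij_betw_finite[OF \<sigma>] by simp
  have inj: "inj_on \<sigma> U" and V_eq: "V = \<sigma> ` U" using \<sigma> by (simp_all add: bij_betw_def)
  have inj_blocks: "inj_on ((`) \<sigma>) \<pi>" using bij_betw_blocks[OF \<pi> \<sigma>] by (simp add: bij_betw_def)
  have sub: "B \<subseteq> U" if "B \<in> \<pi>" for B using partition_onD1[OF \<pi>] that by blast
  have \<gamma>'_block: "\<gamma>' (\<sigma> ` B) = relabel \<sigma> (\<gamma> B)" if "B \<in> \<pi>" for B
    using that by (simp add: \<gamma>'_def bij_betw_vimage_image[OF \<sigma> sub])
  have "((`) \<sigma> ` \<pi>, relabel ((`) \<sigma>) f, \<gamma>') \<in> structures (graph_species P \<circ>\<^sub>S graph_species Q) V"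
    using species_transport_in[OF is_species_comp[OF P Q] U \<sigma> s] by (simp add: tr)
  then have "partition_on V ((`) \<sigma> ` \<pi>)" "is_graph (relabel ((`) \<sigma>) f)"
      "verts (relabel ((`) \<sigma>) f) = (`) \<sigma> ` \<pi>" "\<And>C. C \<in> (`) \<sigma> ` \<pi> \<Longrightarrow> is_graph (\<gamma>' C)"
      "\<And>C. C \<in> (`) \<sigma> ` \<pi> \<Longrightarrow> verts (\<gamma>' C) = C"
    unfolding structures_graph_comp_iff by auto
  \<comment> \<open>The relabeled data satisfy the same conditions, so adjacency can be read off on both sides.\<close>
  note target = V this
  note source = U \<pi> f \<gamma>
  show ?thesis
    unfolding tr unfolding s_eq
  proof (rule graph_eqI)
    show "is_graph (inflate ((`) \<sigma> ` \<pi>, relabel ((`) \<sigma>) f, \<gamma>'))"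
      by (rule is_graph_inflate[OF target])
    show "is_graph (relabel \<sigma> (inflate (\<pi>, f, \<gamma>)))"
      using is_graph_inflate[OF source] verts_inflate[OF source] inj by (simp add: is_graph_relabel)
    show "verts (inflate ((`) \<sigma> ` \<pi>, relabel ((`) \<sigma>) f, \<gamma>')) = verts (relabel \<sigma> (inflate (\<pi>, f, \<gamma>)))"
      using verts_inflate[OF target] verts_inflate[OF source] V_eq by simp
    fix x y
    assume "x \<in> verts (inflate ((`) \<sigma> ` \<pi>, relabel ((`) \<sigma>) f, \<gamma>'))"
      and "y \<in> verts (inflate ((`) \<sigma> ` \<pi>, relabel ((`) \<sigma>) f, \<gamma>'))"
    then obtain u v where x: "x = \<sigma> u" "u \<in> U" and y: "y = \<sigma> v" "v \<in> U"
      using verts_inflate[OF target] V_eq by auto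
    then obtain B C where B: "B \<in> \<pi>" "u \<in> B" and C: "C \<in> \<pi>" "v \<in> C"
      using partition_onD1[OF \<pi>] by blast
    have "{\<sigma> u, \<sigma> v} \<in> edges (inflate ((`) \<sigma> ` \<pi>, relabel ((`) \<sigma>) f, \<gamma>')) \<longleftrightarrow>
        (if \<sigma> ` B = \<sigma> ` C then {\<sigma> u, \<sigma> v} \<in> edges (\<gamma>' (\<sigma> ` B))
         else {\<sigma> ` B, \<sigma> ` C} \<in> edges (relabel ((`) \<sigma>) f))"
      by (rule inflate_adjacent_iff[OF target]) (use B C in auto)
    also have "\<dots> \<longleftrightarrow> (if B = C then {u, v} \<in> edges (\<gamma> B) else {B, C} \<in> edges f)"
    proof (cases "B = C")
      case True
      then show ?thesis
        using relabel_adjacent_iff[OF \<gamma>(1)[OF B(1)], of \<sigma> u v] inj_on_subset[OF inj sub[OF B(1)]] B C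
        by (simp add: \<gamma>'_block \<gamma>(2))
    next
      case False
      then have "\<sigma> ` B \<noteq> \<sigma> ` C" using inj_onD[OF inj_blocks _ B(1) C(1)] by blast
      then show ?thesis
        using False relabel_adjacent_iff[OF f(1), of "(`) \<sigma>" B C] inj_blocks B C by (simp add: f(2))
    qed
    also have "\<dots> \<longleftrightarrow> {u, v} \<in> edges (inflate (\<pi>, f, \<gamma>))"
      by (rule inflate_adjacent_iff[OF source B C, symmetric])
    also have "\<dots> \<longleftrightarrow> {\<sigma> u, \<sigma> v} \<in> edges (relabel \<sigma> (inflate (\<pi>, f, \<gamma>)))"
      by (rule relabel_adjacent_iff[symmetric])
        (use is_graph_inflate[OF source] verts_inflate[OF source] inj x y in auto)
    finally show "{x, y} \<in> edges (inflate ((`) \<sigma> ` \<pi>, relabel ((`) \<sigma>) f, \<gamma>')) \<longleftrightarrow>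
        {x, y} \<in> edges (relabel \<sigma> (inflate (\<pi>, f, \<gamma>)))"
      by (simp add: x y)
  qed
qed

section \<open>Twin classes\<close>

definition twin_class :: "'a graph \<Rightarrow> 'a \<Rightarrow> 'a set" where
  "twin_class g u = {v \<in> verts g. neighborhood g v = neighborhood g u}"

definition collapse :: "'a graph \<Rightarrow> 'a set set \<times> 'a set graph \<times> ('a set \<Rightarrow> 'a graph)" where
  "collapse g = (twin_class g ` verts g, relabel (twin_class g) g,
     \<lambda>B\<in>twin_class g ` verts g. (B, {}))"

lemma twin_class_eq_iff:
  "u \<in> verts g \<Longrightarrow> v \<in> verts g \<Longrightarrow>
    twin_class g u = twin_class g v \<longleftrightarrow> neighborhood g u = neighborhood g v"
  by (auto simp: twin_class_def)

lemma partition_on_twin_classes: "partition_on (verts g) (twin_class g ` verts g)"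
  by (rule partition_onI) (auto simp: twin_class_def disjnt_def)

text \<open>
  If \<open>v\<close> is a neighbor of its twin \<open>u\<close>, then it is also a neighbor of itself.
\<close>

lemma adjacent_imp_twin_class_neq:
  assumes "is_graph g" and uv: "{u, v} \<in> edges g"
  shows "twin_class g u \<noteq> twin_class g v"
proof
  note verts = edge_verts[OF assms]
  assume "twin_class g u = twin_class g v"
  then have "neighborhood g u = neighborhood g v" using verts by (simp add: twin_class_eq_iff)
  moreover have "v \<in> neighborhood g u" using uv verts by (simp add: neighborhood_def)
  ultimately have "{v, v} \<in> edges g" by (simp add: neighborhood_def)
  then show False using edge_verts(3)[OF assms(1)] by blast
qed

text \<open>
  Adjacency is a property of twin classes: replacing \<open>y\<close> by a twin of \<open>y\<close> does not change whether
  it is a neighbor of \<open>x\<close>, and likewise with the roles exchanged. Therefore relabeling along the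
  non-injective map \<open>twin_class g\<close> neither identifies an edge with a nonedge nor creates a loop, and
  it is the quotient graph.
\<close>

lemma twin_quotient_adjacent_iff:
  assumes g: "is_graph g" and u: "u \<in> verts g" and v: "v \<in> verts g"
  shows "{twin_class g u, twin_class g v} \<in> edges (relabel (twin_class g) g) \<longleftrightarrow> {u, v} \<in> edges g"
proof
  have adj: "{u, v} \<in> edges g"
    if xy: "{x, y} \<in> edges g" and "twin_class g x = twin_class g u" "twin_class g y = twin_class g v" for x y
  proof -
    note verts = edge_verts[OF g xy]
    have "y \<in> neighborhood g x" using xy verts by (simp add: neighborhood_def)
    also have "neighborhood g x = neighborhood g u" using that verts u by (simp add: twin_class_eq_iff)
    finally have "u \<in> neighborhood g y" using u by (simp add: neighborhood_def insert_commute)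
    also have "neighborhood g y = neighborhood g v" using that verts v by (simp add: twin_class_eq_iff)
    finally show ?thesis by (simp add: neighborhood_def insert_commute)
  qed
  assume "{twin_class g u, twin_class g v} \<in> edges (relabel (twin_class g) g)"
  then obtain e where e: "e \<in> edges g" "twin_class g ` e = {twin_class g u, twin_class g v}"
    by (auto simp: relabel_def)
  obtain x y where "e = {x, y}"
    using g e(1) by (auto simp: is_graph_def card_2_iff)
  then have xy: "{x, y} \<in> edges g" "{y, x} \<in> edges g"
    and eq: "{twin_class g x, twin_class g y} = {twin_class g u, twin_class g v}"
    using e by (simp_all add: insert_commute)
  from eq consider "twin_class g x = twin_class g u" "twin_class g y = twin_class g v"
    | "twin_class g x = twin_class g v" "twin_class g y = twin_class g u"
    unfolding doubleton_eq_iff by (elim disjE conjE)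
  then show "{u, v} \<in> edges g"
    by cases (erule (1) adj[OF xy(1)], erule (1) adj[OF xy(2)])
next
  assume "{u, v} \<in> edges g"
  then have "twin_class g ` {u, v} \<in> edges (relabel (twin_class g) g)"
    unfolding relabel_def snd_conv by (rule imageI)
  then show "{twin_class g u, twin_class g v} \<in> edges (relabel (twin_class g) g)"
    by simp
qed

lemma is_graph_twin_quotient:
  assumes g: "is_graph g"
  shows "is_graph (relabel (twin_class g) g)"
proof -
  have "twin_class g ` e \<subseteq> twin_class g ` verts g \<and> card (twin_class g ` e) = 2" if "e \<in> edges g" for e
  proof -
    from that g obtain u v where e: "e = {u, v}" by (auto simp: is_graph_def card_2_iff)
    then show ?thesis
      using edge_verts[OF g] adjacent_imp_twin_class_neq[OF g] that by auto
  qed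
  then show ?thesis using g by (auto simp: is_graph_def relabel_def)
qed

text \<open>
  The neighborhood of a vertex is a union of twin classes and so can be recovered from the
  neighborhood of its class in the quotient.
\<close>

lemma point_determining_twin_quotient:
  assumes g: "is_graph g"
  shows "point_determining (relabel (twin_class g) g)"
proof -
  let ?q = "relabel (twin_class g) g"
  have nb: "w \<in> neighborhood g u \<longleftrightarrow> twin_class g w \<in> neighborhood ?q (twin_class g u)"
    if "u \<in> verts g" "w \<in> verts g" for u w
    using that twin_quotient_adjacent_iff[OF g] by (simp add: neighborhood_def)
  have "twin_class g u = twin_class g v"
    if "u \<in> verts g" "v \<in> verts g"
      and "neighborhood ?q (twin_class g u) = neighborhood ?q (twin_class g v)" for u v
  proof -
    have "w \<in> neighborhood g u \<longleftrightarrow> w \<in> neighborhood g v" for w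
    proof (cases "w \<in> verts g")
      case True
      then show ?thesis using nb[OF that(1) True] nb[OF that(2) True] that(3) by simp
    qed (simp add: neighborhood_def)
    then show ?thesis using that by (auto simp: twin_class_eq_iff)
  qed
  then show ?thesis by (auto simp: point_determining_def)
qed

lemma collapse_in_structures:
  assumes "is_graph g"
  shows "collapse g \<in> structures (PointDet \<circ>\<^sub>S EdgelessPlus) (verts g)"
proof -
  have "is_graph (B, {}) \<and> B \<noteq> {}" if "B \<in> twin_class g ` verts g" for B
    using assms that finite_subset[of B "verts g"] by (auto simp: is_graph_def twin_class_def)
  then show ?thesis
    using assms unfolding collapse_def PointDet_def EdgelessPlus_def structures_graph_comp_iff
    by (simp add: partition_on_twin_classes is_graph_twin_quotient point_determining_twin_quotient
        edgeless_def)
qed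

text \<open>
  The quotient accounts for all pairs of vertices from different classes; pairs of twins are not
  adjacent, in agreement with the edgeless blocks.
\<close>

lemma inflate_collapse:
  assumes g: "is_graph g"
  shows "inflate (collapse g) = g"
proof -
  let ?\<pi> = "twin_class g ` verts g" and ?q = "relabel (twin_class g) g"
  let ?\<gamma> = "\<lambda>B\<in>twin_class g ` verts g. (B, {}) :: 'a graph"
  have fin: "finite (verts g)" using g by (simp add: is_graph_def)
  have "is_graph (?\<gamma> B)" "verts (?\<gamma> B) = B" if "B \<in> ?\<pi>" for B
    using collapse_in_structures[OF g] that
    unfolding collapse_def PointDet_def EdgelessPlus_def structures_graph_comp_iff by blast+
  note hyps = fin partition_on_twin_classes is_graph_twin_quotient[OF g] verts_relabel this
  have "inflate (?\<pi>, ?q, ?\<gamma>) = g"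
  proof (rule graph_eqI)
    fix u v assume "u \<in> verts (inflate (?\<pi>, ?q, ?\<gamma>))" "v \<in> verts (inflate (?\<pi>, ?q, ?\<gamma>))"
    then have uv: "u \<in> verts g" "v \<in> verts g" by (simp_all add: verts_inflate[OF hyps])
    have "{u, v} \<in> edges (inflate (?\<pi>, ?q, ?\<gamma>)) \<longleftrightarrow>
      (if twin_class g u = twin_class g v then {u, v} \<in> edges (?\<gamma> (twin_class g u))
       else {twin_class g u, twin_class g v} \<in> edges ?q)"
      by (rule inflate_adjacent_iff[OF hyps]) (use uv in \<open>auto simp: twin_class_def\<close>)
    also have "\<dots> \<longleftrightarrow> {u, v} \<in> edges g"
      using uv adjacent_imp_twin_class_neq[OF g, of u v] twin_quotient_adjacent_iff[OF g]
      by auto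
    finally show "{u, v} \<in> edges (inflate (?\<pi>, ?q, ?\<gamma>)) \<longleftrightarrow> {u, v} \<in> edges g" .
  qed (simp_all add: g is_graph_inflate[OF hyps] verts_inflate[OF hyps])
  then show ?thesis by (simp add: collapse_def)
qed

text \<open>
  In the inflated graph, the neighborhood of a vertex of block \<open>B\<close> is the union of the neighbors of
  \<open>B\<close> in \<open>f\<close>. Blocks being nonempty and disjoint, this union determines the neighborhood of \<open>B\<close>,
  hence \<open>B\<close> itself because \<open>f\<close> is point-determining. So the twin classes are exactly the blocks,
  and \<open>f\<close> is the quotient graph.
\<close>

lemma collapse_inflate:
  assumes U: "finite U" and s: "s \<in> structures (PointDet \<circ>\<^sub>S EdgelessPlus) U"
  shows "collapse (inflate s) = s"
proof -
  obtain \<pi> f \<gamma> where s_eq: "s = (\<pi>, f, \<gamma>)" by (cases s)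
  have \<pi>: "partition_on U \<pi>" and f: "is_graph f" "verts f = \<pi>" and pd: "point_determining f"
    and ext: "\<gamma> \<in> extensional \<pi>"
    and \<gamma>: "\<And>B. B \<in> \<pi> \<Longrightarrow> is_graph (\<gamma> B)" "\<And>B. B \<in> \<pi> \<Longrightarrow> verts (\<gamma> B) = B"
    and edgeless: "\<And>B. B \<in> \<pi> \<Longrightarrow> edges (\<gamma> B) = {}"
    using s by (simp_all add: s_eq PointDet_def EdgelessPlus_def structures_graph_comp_iff edgeless_def)
  note hyps = U \<pi> f \<gamma>
  define g where "g = inflate (\<pi>, f, \<gamma>)"
  have g: "is_graph g" and vg: "verts g = U"
    by (simp_all add: g_def is_graph_inflate[OF hyps] verts_inflate[OF hyps])
  have adj: "{u, v} \<in> edges g \<longleftrightarrow> {B, C} \<in> edges f"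
    if "B \<in> \<pi>" "u \<in> B" "C \<in> \<pi>" "v \<in> C" for u v B C
    using inflate_adjacent_iff[OF hyps that] edgeless[OF that(1)] edge_verts(3)[OF f(1), of B C]
    by (auto simp: g_def)
  have cover: "\<exists>B\<in>\<pi>. u \<in> B" if "u \<in> U" for u using partition_onD1[OF \<pi>] that by blast
  have nonempty: "\<exists>u. u \<in> B \<and> u \<in> U" if "B \<in> \<pi>" for B
    using partition_onD1[OF \<pi>] partition_onD3[OF \<pi>] that by (metis UnionI ex_in_conv)
  have same_block: "C = B" if B: "B \<in> \<pi>" "u \<in> B" and C: "C \<in> \<pi>" "v \<in> C"
    and eq: "neighborhood g v = neighborhood g u" for u v B C
  proof -
    have "D \<in> neighborhood f C \<longleftrightarrow> D \<in> neighborhood f B" for D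
    proof (cases "D \<in> \<pi>")
      case True
      then obtain w where w: "w \<in> D" "w \<in> U" using nonempty by blast
      then have "w \<in> neighborhood g v \<longleftrightarrow> w \<in> neighborhood g u" by (simp add: eq)
      then show ?thesis
        using adj[OF B True w(1)] adj[OF C True w(1)] w True by (simp add: neighborhood_def vg f(2))
    qed (simp add: neighborhood_def f(2))
    then have "neighborhood f C = neighborhood f B" by blast
    then show ?thesis using pd B C by (auto simp: point_determining_def f(2))
  qed
  have twin_class_block: "twin_class g u = B" if B: "B \<in> \<pi>" "u \<in> B" for u B
  proof (rule set_eqI)
    fix v
    show "v \<in> twin_class g u \<longleftrightarrow> v \<in> B"
    proof
      assume "v \<in> twin_class g u"
      then show "v \<in> B" using cover[of v] same_block[OF B] by (auto simp: twin_class_def vg)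
    next
      assume v: "v \<in> B"
      have "w \<in> neighborhood g v \<longleftrightarrow> w \<in> neighborhood g u" for w
        using cover[of w] adj[OF B] adj[OF B(1) v] by (auto simp: neighborhood_def vg)
      then show "v \<in> twin_class g u"
        using partition_onD1[OF \<pi>] B(1) v by (auto simp: twin_class_def vg)
    qed
  qed
  have classes: "twin_class g ` verts g = \<pi>"
  proof
    show "twin_class g ` verts g \<subseteq> \<pi>" using cover twin_class_block by (auto simp: vg)
    show "\<pi> \<subseteq> twin_class g ` verts g" using nonempty twin_class_block by (metis vg image_eqI subsetI)
  qed
  have quotient: "relabel (twin_class g) g = f"
  proof (rule graph_eqI)
    fix B C assume "B \<in> verts (relabel (twin_class g) g)" "C \<in> verts (relabel (twin_class g) g)"
    then have BC: "B \<in> \<pi>" "C \<in> \<pi>" by (simp_all add: classes)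
    then obtain u v where uv: "u \<in> B" "u \<in> U" "v \<in> C" "v \<in> U" using nonempty by metis
    then show "{B, C} \<in> edges (relabel (twin_class g) g) \<longleftrightarrow> {B, C} \<in> edges f"
      using twin_quotient_adjacent_iff[OF g, of u v] adj[OF BC(1) _ BC(2), of u v] BC
      by (simp add: twin_class_block vg)
  qed (simp_all add: is_graph_twin_quotient[OF g] f classes)
  have "(\<lambda>B\<in>\<pi>. (B, {})) = \<gamma>"
  proof (rule extensionalityI[OF restrict_extensional ext])
    fix B assume "B \<in> \<pi>"
    then show "(\<lambda>B\<in>\<pi>. (B, {})) B = \<gamma> B" using \<gamma>(2) edgeless by (simp add: prod_eq_iff)
  qed
  then show ?thesis
    by (simp add: s_eq collapse_def classes quotient flip: g_def)
qed

lemma inflate_in_Graphs: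
  assumes "finite U" and s: "s \<in> structures (graph_species P \<circ>\<^sub>S graph_species Q) U"
  shows "is_graph (inflate s)" and "verts (inflate s) = U"
proof -
  obtain \<pi> f \<gamma> where s_eq: "s = (\<pi>, f, \<gamma>)" by (cases s)
  then have "partition_on U \<pi>" "is_graph f" "verts f = \<pi>"
      "\<And>B. B \<in> \<pi> \<Longrightarrow> is_graph (\<gamma> B)" "\<And>B. B \<in> \<pi> \<Longrightarrow> verts (\<gamma> B) = B"
    using s by (simp_all add: structures_graph_comp_iff)
  note hyps = assms(1) this
  show "is_graph (inflate s)" "verts (inflate s) = U"
    by (simp_all add: s_eq is_graph_inflate[OF hyps] verts_inflate[OF hyps])
qed

lemma bij_betw_inflate_edgeless:
  assumes "finite U"
  shows "bij_betw inflate (structures (PointDet \<circ>\<^sub>S EdgelessPlus) U) (structures Graphs U)"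
proof (rule bij_betw_byWitness[where f' = collapse])
  show "\<forall>s\<in>structures (PointDet \<circ>\<^sub>S EdgelessPlus) U. collapse (inflate s) = s"
    using collapse_inflate[OF assms] by blast
  show "\<forall>g\<in>structures Graphs U. inflate (collapse g) = g"
    by (simp add: Graphs_def inflate_collapse)
  show "inflate ` structures (PointDet \<circ>\<^sub>S EdgelessPlus) U \<subseteq> structures Graphs U"
    using inflate_in_Graphs[OF assms] by (auto simp: Graphs_def PointDet_def EdgelessPlus_def)
  show "collapse ` structures Graphs U \<subseteq> structures (PointDet \<circ>\<^sub>S EdgelessPlus) U"
    using collapse_in_structures by (auto simp: Graphs_def)
qed

section \<open>Complementation\<close>

definition complement_all ::
  "'a set set \<times> 'a set graph \<times> ('a set \<Rightarrow> 'a graph) \<Rightarrow>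
   'a set set \<times> 'a set graph \<times> ('a set \<Rightarrow> 'a graph)" where
  "complement_all = (\<lambda>(\<pi>, f, \<gamma>). (\<pi>, complement f, \<lambda>B\<in>\<pi>. complement (\<gamma> B)))"

lemma complement_all_involutive:
  assumes "s \<in> structures (graph_species P \<circ>\<^sub>S graph_species Q) U"
  shows "complement_all (complement_all s) = s"
proof -
  obtain \<pi> f \<gamma> where s: "s = (\<pi>, f, \<gamma>)" by (cases s)
  have "(\<lambda>B\<in>\<pi>. complement ((\<lambda>B\<in>\<pi>. complement (\<gamma> B)) B)) = \<gamma>"
    using assms by (intro extensionalityI[of _ \<pi>])
      (auto simp: s structures_graph_comp_iff complement_complement)
  then show ?thesis
    using assms by (simp add: s structures_graph_comp_iff complement_all_def complement_complement)
qed

lemma complement_all_in_structures: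
  assumes "s \<in> structures (graph_species P \<circ>\<^sub>S graph_species Q) U"
    and "\<And>g. is_graph g \<Longrightarrow> P g \<Longrightarrow> P' (complement g)"
    and "\<And>g. is_graph g \<Longrightarrow> Q g \<Longrightarrow> Q' (complement g)"
  shows "complement_all s \<in> structures (graph_species P' \<circ>\<^sub>S graph_species Q') U"
proof -
  obtain \<pi> f \<gamma> where s: "s = (\<pi>, f, \<gamma>)" by (cases s)
  show ?thesis
    using assms by (simp add: s structures_graph_comp_iff complement_all_def)
qed

lemma bij_betw_complement_all:
  "bij_betw complement_all (structures (CoPointDet \<circ>\<^sub>S CompletePlus) U)
     (structures (PointDet \<circ>\<^sub>S EdgelessPlus) U)"
proof (rule bij_betw_byWitness[where f' = complement_all])
  show "\<forall>s\<in>structures (CoPointDet \<circ>\<^sub>S CompletePlus) U. complement_all (complement_all s) = s"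
    using complement_all_involutive unfolding CoPointDet_def CompletePlus_def by blast
  show "\<forall>s\<in>structures (PointDet \<circ>\<^sub>S EdgelessPlus) U. complement_all (complement_all s) = s"
    using complement_all_involutive unfolding PointDet_def EdgelessPlus_def by blast
  show "complement_all ` structures (CoPointDet \<circ>\<^sub>S CompletePlus) U
      \<subseteq> structures (PointDet \<circ>\<^sub>S EdgelessPlus) U"
    unfolding CoPointDet_def CompletePlus_def PointDet_def EdgelessPlus_def
    by (rule image_subsetI, erule complement_all_in_structures)
       (simp_all add: co_point_determining_def edgeless_complement_iff)
  show "complement_all ` structures (PointDet \<circ>\<^sub>S EdgelessPlus) U
      \<subseteq> structures (CoPointDet \<circ>\<^sub>S CompletePlus) U"
    unfolding CoPointDet_def CompletePlus_def PointDet_def EdgelessPlus_def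
    by (rule image_subsetI, erule complement_all_in_structures)
       (simp_all add: co_point_determining_def complement_complement complete_complement)
qed

text \<open>
  A pair of vertices is governed either by \<open>f\<close> or by the graph on one block, and complementing
  toggles its adjacency in both cases.
\<close>

lemma inflate_complement_all:
  assumes U: "finite U" and s: "s \<in> structures (graph_species P \<circ>\<^sub>S graph_species Q) U"
  shows "inflate (complement_all s) = complement (inflate s)"
proof -
  obtain \<pi> f \<gamma> where s_eq: "s = (\<pi>, f, \<gamma>)" by (cases s)
  have \<pi>: "partition_on U \<pi>" and f: "is_graph f" "verts f = \<pi>"
    and \<gamma>: "\<And>B. B \<in> \<pi> \<Longrightarrow> is_graph (\<gamma> B)" "\<And>B. B \<in> \<pi> \<Longrightarrow> verts (\<gamma> B) = B"
    using s by (simp_all add: s_eq structures_graph_comp_iff)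
  define \<gamma>' where "\<gamma>' = (\<lambda>B\<in>\<pi>. complement (\<gamma> B))"
  have compl: "complement_all s = (\<pi>, complement f, \<gamma>')"
    by (simp add: s_eq complement_all_def \<gamma>'_def)
  have \<gamma>'_block: "\<gamma>' B = complement (\<gamma> B)" if "B \<in> \<pi>" for B
    using that by (simp add: \<gamma>'_def)
  have \<gamma>': "\<And>B. B \<in> \<pi> \<Longrightarrow> is_graph (\<gamma>' B)" "\<And>B. B \<in> \<pi> \<Longrightarrow> verts (\<gamma>' B) = B"
    using \<gamma> by (simp_all add: \<gamma>'_block)
  have cf: "is_graph (complement f)" "verts (complement f) = \<pi>" using f by simp_all
  note source = U \<pi> f \<gamma> and target = U \<pi> cf \<gamma>'
  have "inflate (\<pi>, complement f, \<gamma>') = complement (inflate (\<pi>, f, \<gamma>))"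
  proof (rule graph_eqI)
    fix u v assume "u \<in> verts (inflate (\<pi>, complement f, \<gamma>'))" "v \<in> verts (inflate (\<pi>, complement f, \<gamma>'))"
      and neq: "u \<noteq> v"
    then have uv: "u \<in> U" "v \<in> U" by (simp_all add: verts_inflate[OF target])
    then obtain B C where B: "B \<in> \<pi>" "u \<in> B" and C: "C \<in> \<pi>" "v \<in> C"
      using partition_onD1[OF \<pi>] by blast
    show "{u, v} \<in> edges (inflate (\<pi>, complement f, \<gamma>')) \<longleftrightarrow>
        {u, v} \<in> edges (complement (inflate (\<pi>, f, \<gamma>)))"
      using uv neq B C
      by (auto simp: inflate_adjacent_iff[OF source B C] inflate_adjacent_iff[OF target B C]
          complement_adjacent_iff verts_inflate[OF source] \<gamma>'_block \<gamma> f)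
  qed (simp_all add: is_graph_inflate[OF target] is_graph_inflate[OF source]
      verts_inflate[OF target] verts_inflate[OF source])
  then show ?thesis using compl by (simp add: s_eq)
qed

lemma bij_betw_complement: "bij_betw complement (structures Graphs U) (structures Graphs U)"
  by (rule bij_betw_byWitness[where f' = complement])
     (auto simp: Graphs_def complement_complement)

text \<open>
  As complementation is an involution, \<open>inflate\<close> is here its own conjugate
  \<open>complement \<circ> inflate \<circ> complement_all\<close>, which passes through the edgeless case.
\<close>

lemma bij_betw_inflate_complete:
  assumes U: "finite U"
  shows "bij_betw inflate (structures (CoPointDet \<circ>\<^sub>S CompletePlus) U) (structures Graphs U)"
proof -
  have "bij_betw (complement \<circ> (inflate \<circ> complement_all))
      (structures (CoPointDet \<circ>\<^sub>S CompletePlus) U) (structures Graphs U)"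
    by (intro bij_betw_trans[OF bij_betw_trans[OF bij_betw_complement_all
            bij_betw_inflate_edgeless[OF U]] bij_betw_complement])
  moreover have "(complement \<circ> (inflate \<circ> complement_all)) s = inflate s"
    if "s \<in> structures (CoPointDet \<circ>\<^sub>S CompletePlus) U" for s
    using that inflate_complement_all[OF U] inflate_in_Graphs[OF U]
    by (simp add: CoPointDet_def CompletePlus_def complement_complement)
  ultimately show ?thesis by (simp cong: bij_betw_cong)
qed

section \<open>The two decompositions\<close>

lemma species_iso_Graphs_if_bij_inflate:
  assumes P: "is_species (graph_species P)" and Q: "is_species (graph_species Q)"
    and bij: "\<And>U. finite U \<Longrightarrow>
      bij_betw inflate (structures (graph_species P \<circ>\<^sub>S graph_species Q) U) (structures Graphs U)"
  shows "graph_species P \<circ>\<^sub>S graph_species Q \<cong>\<^sub>S Graphs"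
proof -
  have "natural_iso (graph_species P \<circ>\<^sub>S graph_species Q) Graphs (\<lambda>U. inflate)"
    using bij by (intro natural_isoI) (simp_all add: Graphs_def inflate_natural[OF P Q])
  moreover have "is_species Graphs"
    unfolding Graphs_def by (rule is_species_graph_species)
  ultimately show ?thesis
    using is_species_comp[OF P Q] by (auto simp: species_iso_def)
qed

theorem theorem2p2:
  shows "(Graphs :: ('a, 'a graph) species) \<cong>\<^sub>S PointDet \<circ>\<^sub>S EdgelessPlus \<and>
         (PointDet \<circ>\<^sub>S EdgelessPlus :: ('a, _) species) \<cong>\<^sub>S CoPointDet \<circ>\<^sub>S CompletePlus"
proof -
  have edgeless: "(PointDet \<circ>\<^sub>S EdgelessPlus :: ('a, _) species) \<cong>\<^sub>S Graphs"
    using bij_betw_inflate_edgeless unfolding PointDet_def EdgelessPlus_def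
    by (intro species_iso_Graphs_if_bij_inflate is_species_graph_species)
       (simp_all add: point_determining_relabel edgeless_relabel)
  have complete: "(CoPointDet \<circ>\<^sub>S CompletePlus :: ('a, _) species) \<cong>\<^sub>S Graphs"
    using bij_betw_inflate_complete unfolding CoPointDet_def CompletePlus_def
    by (intro species_iso_Graphs_if_bij_inflate is_species_graph_species)
       (simp_all add: co_point_determining_relabel complete_relabel)
  show ?thesis
    using species_iso_sym[OF edgeless] species_iso_trans[OF edgeless species_iso_sym[OF complete]] by simp
qed

end
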